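(* Let $\{f_1, f_2, \dots, f_n\}$ be a set of affine maps on $\mathbb{R}^m$ satisfying the Open Set Condition. Let $k \ge 1$ be a fixed integer. Suppose that every composition of length $k$ chosen from the set $\{f_1, \dots, f_n\}$ (that is, every map $f_{j_1}\circ\cdots\circ f_{j_k}$ with $j_1,\dots,j_k\in\{1,\dots,n\}$) is a similarity contraction. Then there exists a unique non-empty compact set $A$ (the attractor) satisfying $A = \bigcup_{i=1}^n f_i(A)$. Moreover, letting $c_i$ denote the contraction ratio of the $k$-fold composition $f_i^k = f_i \circ \dots \circ f_i$, the Hausdorff dimension $s = \dim_H(A)$ is the unique solution to $$\sum_{i=1}^n c_i^{s/k} = 1.$$
   Context: A similarity contraction of $\mathbb{R}^m$ with contraction ratio $\rho\in(0,1)$ is a map $h$ with $\|h(x)-h(y)\|=\rho\|x-y\|$ for all $x,y\in\mathbb{R}^m$ (Euclidean norm). Open Set Condition for $\{f_1,\dots,f_n\}$: there is a non-empty open set $U\subset\mathbb{R}^m$ with $\bigcup_i f_i(U)\subset U$ and $f_i(U)\cap f_j(U)=\emptyset$ for $i\ne j$. $\dim_H$ denotes Hausdorff dimension. *)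

theory Defs
  imports "HOL-Analysis.Analysis"
begin

definition affine_map :: "('a::real_vector \<Rightarrow> 'b::real_vector) \<Rightarrow> bool" where
  "affine_map h \<longleftrightarrow> (\<exists>L b. linear L \<and> h = (\<lambda>x. L x + b))"

definition has_contraction_ratio :: "('a::real_normed_vector \<Rightarrow> 'a) \<Rightarrow> real \<Rightarrow> bool" where
  "has_contraction_ratio h \<rho> \<longleftrightarrow>
     0 < \<rho> \<and> \<rho> < 1 \<and> (\<forall>x y. norm (h x - h y) = \<rho> * norm (x - y))"

definition similarity_contraction :: "('a::real_normed_vector \<Rightarrow> 'a) \<Rightarrow> bool" where
  "similarity_contraction h \<longleftrightarrow> (\<exists>\<rho>. has_contraction_ratio h \<rho>)"

(* The ratio of a similarity contraction is unique as soon as the space is not {0},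
   which holds in every real ^ 'm. *)
definition contraction_ratio :: "('a::real_normed_vector \<Rightarrow> 'a) \<Rightarrow> real" where
  "contraction_ratio h = (THE \<rho>. has_contraction_ratio h \<rho>)"

definition open_set_condition :: "'i set \<Rightarrow> ('i \<Rightarrow> 'a::topological_space \<Rightarrow> 'a) \<Rightarrow> bool" where
  "open_set_condition I f \<longleftrightarrow>
     (\<exists>U. open U \<and> U \<noteq> {} \<and> (\<Union>i\<in>I. f i ` U) \<subseteq> U \<and>
        (\<forall>i\<in>I. \<forall>j\<in>I. i \<noteq> j \<longrightarrow> f i ` U \<inter> f j ` U = {}))"

(* compose_word f [j1, ..., jk] is f j1 o ... o f jk, the last map being applied first. *)
definition compose_word :: "('i \<Rightarrow> 'a \<Rightarrow> 'a) \<Rightarrow> 'i list \<Rightarrow> 'a \<Rightarrow> 'a" where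
  "compose_word f js = foldr (\<circ>) (map f js) id"

definition is_attractor ::
    "'i set \<Rightarrow> ('i \<Rightarrow> 'a::topological_space \<Rightarrow> 'a) \<Rightarrow> 'a set \<Rightarrow> bool" where
  "is_attractor I f A \<longleftrightarrow> compact A \<and> A \<noteq> {} \<and> A = (\<Union>i\<in>I. f i ` A)"

(* diam(U)^s with the conventions diam({})^s = 0 and diam(U)^0 = 1 for nonempty U.
   The case s = 0 is explicit because 0 powr 0 = 0. *)
definition diam_power :: "real \<Rightarrow> 'a::metric_space set \<Rightarrow> ennreal" where
  "diam_power s U =
     (if U = {} then 0 else if s = 0 then 1 else ennreal (diameter U powr s))"

(* Finite covers are included, since the members of a cover may be empty.
   Boundedness is required because diameter is unspecified on unbounded sets. *)
definition hausdorff_premeasure :: "real \<Rightarrow> real \<Rightarrow> 'a::metric_space set \<Rightarrow> ennreal" where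
  "hausdorff_premeasure s \<delta> A =
     (INF U \<in> {U :: nat \<Rightarrow> 'a set.
          A \<subseteq> (\<Union>i. U i) \<and> (\<forall>i. bounded (U i) \<and> diameter (U i) \<le> \<delta>)}.
        \<Sum>i. diam_power s (U i))"

definition hausdorff_measure :: "real \<Rightarrow> 'a::metric_space set \<Rightarrow> ennreal" where
  "hausdorff_measure s A = (SUP \<delta>\<in>{0<..}. hausdorff_premeasure s \<delta> A)"

definition hausdorff_dim :: "'a::metric_space set \<Rightarrow> ereal" where
  "hausdorff_dim A = Inf (ereal ` {s. 0 \<le> s \<and> hausdorff_measure s A = 0})"

end

theory Submission
  imports Defs
begin

text \<open>
  The maps themselves need not be similarities, but the system of all compositions of length \<open>k\<close>
  consists of similarities, and everything is reduced to it.

  The attractor of this system of words exists and is unique because the words contract. The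
  Hutchinson operator of the letters commutes with its \<open>k\<close>-th power, which is the operator of the
  words; so it fixes the attractor of the words, and every attractor of the letters is one of the
  words (\<open>attractor_unique_if_words_contract\<close>).

  The absolute determinant of the linear part is multiplicative under composition and equals
  $\rho^m$ for a similarity of ratio $\rho$. Consequently the word $j_1 \ldots j_k$ has the ratio
  $c_{j_1}^{1/k} \cdots c_{j_k}^{1/k}$ (\<open>word_ratio_from_letter_ratios\<close>), and the Moran sum of the
  words at exponent $s$ is the \<open>k\<close>-th power of $\sum_i c_i^{s/k}$. Both equal $1$ for the same
  $s \geq 0$. The open set condition passes from letters to words
  (\<open>open_set_condition_words\<close>), so the claim follows from the theorem of Moran and Hutchinson for
  self-similar sets (\<open>hausdorff_dim_self_similar\<close>).

  In that theorem the upper bound comes from covering the attractor by its pieces of a high level.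
  For the lower bound a unit mass is distributed over the orbit of one point of the attractor, the
  piece of a word receiving the \<open>s\<close>-th power of its ratio. A set of diameter \<open>d\<close> meets only a bounded
  number of pieces of size about \<open>d\<close>, because these pieces come with disjoint balls of radius
  comparable to \<open>d\<close>; so it carries a mass of at most a constant times $d^s$
  (\<open>orbit_mass_volume_bound\<close>, \<open>orbit_mass_le_diameter_power\<close>). Hence the sum of $d_j^s$ over the
  members of any cover is bounded below.
\<close>

section \<open>The Moran equation\<close>

text \<open>The left-hand side is strictly decreasing in the exponent, equals the number of ratios at
  exponent $0$ and tends to $0$ at infinity. If there is a single ratio, the solution is $0$.\<close>

lemma moran_equation:
  fixes r :: "'i \<Rightarrow> real"
  assumes "finite I" "I \<noteq> {}" and r: "\<And>i. i \<in> I \<Longrightarrow> 0 < r i \<and> r i < 1"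
  shows "\<exists>s\<ge>0. (\<Sum>i\<in>I. r i powr s) = 1 \<and> (\<forall>t. (\<Sum>i\<in>I. r i powr t) = 1 \<longrightarrow> t = s)"
proof -
  define \<phi> where "\<phi> t = (\<Sum>i\<in>I. r i powr t)" for t
  have dec: "\<phi> t < \<phi> u" if "u < t" for t u
    unfolding \<phi>_def
  proof (rule sum_strict_mono)
    show "r i powr t < r i powr u" if "i \<in> I" for i
      using r[OF that] \<open>u < t\<close> by (intro powr_less_mono') auto
  qed (use assms in auto)
  have "((\<lambda>t. r i powr t) \<longlongrightarrow> 0) at_top" if "i \<in> I" for i
  proof -
    have "filterlim (\<lambda>t. t * ln (r i)) at_bot at_top"
      using r[OF that] by (intro filterlim_tendsto_neg_mult_at_bot[OF _ _ filterlim_ident, of "\<lambda>_. ln (r i)" "ln (r i)", unfolded mult.commute[of "ln (r i)"]]) auto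
    then have "((\<lambda>t. exp (t * ln (r i))) \<longlongrightarrow> 0) at_top"
      by (rule filterlim_compose[OF exp_at_bot])
    then show ?thesis using r[OF that] by (simp add: powr_def)
  qed
  then have "(\<phi> \<longlongrightarrow> (\<Sum>i\<in>I. 0)) at_top"
    unfolding \<phi>_def by (intro tendsto_sum)
  then have "eventually (\<lambda>t. \<phi> t < 1) at_top"
    by (auto intro: order_tendstoD)
  then obtain T where T: "\<And>t. t \<ge> T \<Longrightarrow> \<phi> t < 1"
    by (auto simp: eventually_at_top_linorder)
  have "\<phi> 0 = (\<Sum>i\<in>I. 1)"
    unfolding \<phi>_def using r by (intro sum.cong) fastforce+
  also have "\<dots> \<ge> 1"
    using assms(1,2) by (simp add: Suc_le_eq card_gt_0_iff)
  finally have "1 \<le> \<phi> 0" .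
  moreover have "\<phi> (max T 0) \<le> 1" using T[of "max T 0"] by simp
  moreover have "continuous_on {0..max T 0} \<phi>"
    unfolding \<phi>_def using r by (intro continuous_intros) fastforce+
  ultimately obtain s where "0 \<le> s" "\<phi> s = 1"
    using IVT2'[of \<phi> "max T 0" 1 0] by auto
  moreover have "t = s" if "\<phi> t = 1" for t
    using dec[of t s] dec[of s t] that \<open>\<phi> s = 1\<close> by (cases t s rule: linorder_cases) auto
  ultimately show ?thesis unfolding \<phi>_def by blast
qed

section \<open>Words and the Hutchinson operator\<close>

definition words :: "'i set \<Rightarrow> nat \<Rightarrow> 'i list set" where
  "words I N = {w. set w \<subseteq> I \<and> length w = N}"

lemma finite_words: "finite I \<Longrightarrow> finite (words I N)"
  unfolding words_def by (rule finite_lists_length_eq)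

lemma words_0 [simp]: "words I 0 = {[]}"
  by (auto simp: words_def)

lemma words_Suc: "words I (Suc N) = (\<lambda>(i, w). i # w) ` (I \<times> words I N)"
proof (rule set_eqI)
  fix w show "w \<in> words I (Suc N) \<longleftrightarrow> w \<in> (\<lambda>(i, w). i # w) ` (I \<times> words I N)"
    by (cases w) (auto simp: words_def)
qed

text \<open>Expanding the power of a sum: this turns the Moran sum over all words of length \<open>N\<close> into the
  \<open>N\<close>-th power of the Moran sum over the letters.\<close>

lemma sum_words_prod_list:
  fixes c :: "'i \<Rightarrow> 'a::comm_semiring_1"
  shows "(\<Sum>w\<in>words I N. prod_list (map c w)) = (\<Sum>i\<in>I. c i) ^ N"
proof (induction N)
  case (Suc N)
  have "(\<Sum>w\<in>words I (Suc N). prod_list (map c w))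
      = (\<Sum>(i, w)\<in>I \<times> words I N. c i * prod_list (map c w))"
    unfolding words_Suc by (subst sum.reindex) (auto simp: inj_on_def o_def case_prod_unfold)
  also have "\<dots> = (\<Sum>i\<in>I. c i) * (\<Sum>w\<in>words I N. prod_list (map c w))"
    by (simp add: sum_product sum.cartesian_product)
  finally show ?case by (simp add: Suc.IH)
qed simp

lemma compose_word_Nil [simp]: "compose_word f [] = id"
  and compose_word_Cons [simp]: "compose_word f (i # w) = f i \<circ> compose_word f w"
  by (simp_all add: compose_word_def)

lemma compose_word_replicate: "compose_word f (replicate N i) = f i ^^ N"
  by (induction N) simp_all

definition hutchinson :: "'i set \<Rightarrow> ('i \<Rightarrow> 'a \<Rightarrow> 'a) \<Rightarrow> 'a set \<Rightarrow> 'a set" where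
  "hutchinson I f X = (\<Union>i\<in>I. f i ` X)"

lemma is_attractor_hutchinson:
  "is_attractor I f A \<longleftrightarrow> compact A \<and> A \<noteq> {} \<and> hutchinson I f A = A"
  by (auto simp: is_attractor_def hutchinson_def)

lemma hutchinson_mono: "X \<subseteq> Y \<Longrightarrow> hutchinson I f X \<subseteq> hutchinson I f Y"
  by (auto simp: hutchinson_def)

lemma compact_hutchinson:
  assumes "finite I" "\<And>i. i \<in> I \<Longrightarrow> continuous_on UNIV (f i)" "compact X"
  shows "compact (hutchinson I f X)"
  unfolding hutchinson_def
  using assms by (intro compact_UN compact_continuous_image) (auto intro: continuous_on_subset)

text \<open>Iterating the system \<open>N\<close> times is the same as running the system of all words of length \<open>N\<close>
  once; hence an attractor of the letters is one of the words.\<close>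

lemma hutchinson_words:
  "(hutchinson I f ^^ N) = hutchinson (words I N) (compose_word f)"
proof (induction N)
  case (Suc N)
  have "hutchinson (words I (Suc N)) (compose_word f) X
      = hutchinson I f (hutchinson (words I N) (compose_word f) X)" for X
    unfolding words_Suc hutchinson_def by (force simp: image_iff)
  then show ?case by (simp add: Suc.IH fun_eq_iff)
qed (simp add: hutchinson_def fun_eq_iff)

lemma attractor_words:
  assumes "is_attractor I f A"
  shows "is_attractor (words I N) (compose_word f) A"
proof -
  have "(hutchinson I f ^^ N) A = A"
    using assms by (induction N) (simp_all add: is_attractor_hutchinson)
  then show ?thesis
    using assms by (simp add: hutchinson_words is_attractor_hutchinson)
qed

section \<open>Existence and uniqueness of the attractor\<close>

text \<open>A large ball is mapped into itself, so its iterates decrease, and the attractor is their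
  intersection. That the intersection is covered by its own images needs compactness: for a point
  of it, the preimages in the successive iterates form a decreasing sequence of non-empty compact
  sets.\<close>

lemma attractor_exists:
  fixes g :: "'i \<Rightarrow> 'a::euclidean_space \<Rightarrow> 'a"
  assumes fin: "finite I" "I \<noteq> {}" and q: "0 \<le> q" "q < 1"
    and lip: "\<And>i x y. i \<in> I \<Longrightarrow> dist (g i x) (g i y) \<le> q * dist x y"
  shows "\<exists>A. is_attractor I g A"
proof -
  have cont: "continuous_on UNIV (g i)" if "i \<in> I" for i
  proof (rule lipschitz_on_continuous_on)
    show "q-lipschitz_on UNIV (g i)" using lip[OF that] q by (auto intro: lipschitz_onI)
  qed
  \<comment> \<open>The radius with \<open>(\<Sum>i\<in>I. norm (g i 0)) + q * R = R\<close>.\<close>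
  define R where "R = (\<Sum>i\<in>I. norm (g i 0)) / (1 - q)"
  have step: "hutchinson I g (cball 0 R) \<subseteq> cball 0 R"
  proof (clarsimp simp: hutchinson_def)
    fix i and x :: 'a assume i: "i \<in> I" and x: "norm x \<le> R"
    have "norm (g i x) \<le> norm (g i 0) + dist (g i x) (g i 0)"
      by norm
    also have "\<dots> \<le> (1 - q) * R + q * dist x 0"
    proof (intro add_mono lip i)
      have "norm (g i 0) \<le> (\<Sum>i\<in>I. norm (g i 0))"
        using fin i by (intro member_le_sum) auto
      then show "norm (g i 0) \<le> (1 - q) * R" using q by (simp add: R_def)
    qed
    also have "\<dots> \<le> (1 - q) * R + q * R"
      using x q by (intro add_left_mono mult_left_mono) auto
    finally show "norm (g i x) \<le> R" by (simp add: algebra_simps)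
  qed
  have "0 \<le> R" using q by (simp add: R_def sum_nonneg)
  define K where "K N = (hutchinson I g ^^ N) (cball 0 R)" for N
  have K_Suc: "K (Suc N) = hutchinson I g (K N)" for N by (simp add: K_def)
  have comp: "compact (K N)" for N
    by (induction N) (auto simp: K_Suc intro!: compact_hutchinson fin cont, simp add: K_def)
  have ne: "K N \<noteq> {}" for N
    by (induction N) (use fin \<open>0 \<le> R\<close> in \<open>auto simp: K_def hutchinson_def\<close>)
  have dec1: "K (Suc N) \<subseteq> K N" for N
  proof (induction N)
    case 0 show ?case using step by (simp add: K_def)
  next
    case (Suc N) then show ?case by (metis K_Suc hutchinson_mono)
  qed
  have dec: "K N \<subseteq> K M" if "M \<le> N" for M N
    using lift_Suc_antimono_le[of K, OF dec1 that] .
  define A where "A = (\<Inter>N. K N)"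
  have "compact A" unfolding A_def by (rule compact_Inter) (use comp in auto)
  moreover have "A \<noteq> {}" unfolding A_def by (rule compact_nest) (use comp ne dec in auto)
  moreover have "hutchinson I g A = A"
  proof
    have "hutchinson I g A \<subseteq> K N" for N
      using hutchinson_mono[of A "K N" I g] dec1[of N] by (auto simp: A_def K_Suc)
    then show "hutchinson I g A \<subseteq> A" by (auto simp: A_def)
  next
    show "A \<subseteq> hutchinson I g A"
    proof
      fix x assume "x \<in> A"
      define Y where "Y N = K N \<inter> (\<Union>i\<in>I. g i -` {x})" for N
      have "closed (\<Union>i\<in>I. g i -` {x})"
        using fin(1) by (intro closed_UN ballI closed_vimage closed_singleton cont)
      then have "compact (Y N)" for N unfolding Y_def using comp by auto
      moreover have "Y N \<noteq> {}" for N
      proof -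
        have "x \<in> hutchinson I g (K N)" using \<open>x \<in> A\<close> by (metis A_def INT_E K_Suc UNIV_I)
        then show ?thesis by (auto simp: Y_def hutchinson_def)
      qed
      moreover have "Y N \<subseteq> Y M" if "M \<le> N" for M N
        using dec[OF that] by (auto simp: Y_def)
      ultimately have "\<Inter>(range Y) \<noteq> {}" by (rule compact_nest)
      then show "x \<in> hutchinson I g A"
        by (auto simp: Y_def hutchinson_def A_def)
    qed
  qed
  ultimately show ?thesis by (auto simp: is_attractor_hutchinson)
qed

text \<open>The point of \<open>A\<close> farthest from \<open>B\<close> is the image of a point of \<open>A\<close> under some \<open>g i\<close>, and
  \<open>g i\<close> multiplies the distance to \<open>B\<close> by at most \<open>q\<close>. So the largest distance is zero.\<close>

lemma attractor_subset:
  fixes g :: "'i \<Rightarrow> 'a::heine_borel \<Rightarrow> 'a"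
  assumes q: "0 \<le> q" "q < 1"
    and lip: "\<And>i x y. i \<in> I \<Longrightarrow> dist (g i x) (g i y) \<le> q * dist x y"
    and A: "is_attractor I g A" and B: "is_attractor I g B"
  shows "A \<subseteq> B"
proof -
  have "compact A" "A \<noteq> {}" "closed B" "B \<noteq> {}"
    using A B by (auto simp: is_attractor_def compact_imp_closed)
  moreover have "continuous_on A (\<lambda>x. infdist x B)" by (intro continuous_intros)
  ultimately obtain a where a: "a \<in> A" "\<And>x. x \<in> A \<Longrightarrow> infdist x B \<le> infdist a B"
    using continuous_attains_sup[of A "\<lambda>x. infdist x B"] by blast
  have "a \<in> (\<Union>i\<in>I. g i ` A)" using A a(1) unfolding is_attractor_def by blast
  then obtain i x where i: "i \<in> I" "x \<in> A" "a = g i x" by blast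
  obtain y where y: "y \<in> B" "infdist x B = dist x y"
    using infdist_attains_inf[OF \<open>closed B\<close> \<open>B \<noteq> {}\<close>] by blast
  have "g i y \<in> B" using B i(1) y(1) by (auto simp: is_attractor_def)
  then have "infdist a B \<le> dist a (g i y)" by (rule infdist_le)
  also have "\<dots> \<le> q * infdist x B" using lip[OF i(1)] y(2) i(3) by simp
  also have "\<dots> \<le> q * infdist a B" using a(2)[OF i(2)] q by (intro mult_left_mono)
  finally have "(1 - q) * infdist a B \<le> 0" by (simp add: algebra_simps)
  then have "infdist a B \<le> 0" using q by (simp add: mult_le_0_iff)
  then have "infdist x B = 0" if "x \<in> A" for x
    using a(2)[OF that] infdist_nonneg[of x B] by linarith
  then show "A \<subseteq> B"
    using in_closed_iff_infdist_zero[OF \<open>closed B\<close> \<open>B \<noteq> {}\<close>] by blast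
qed

text \<open>Only the compositions of length \<open>k\<close> contract; single maps may expand. If \<open>A\<close> is the
  attractor of the words, then so is its image under the Hutchinson operator of the letters,
  because that operator commutes with its own powers. Uniqueness for the words makes \<open>A\<close> invariant
  under the letters.\<close>

lemma attractor_unique_if_words_contract:
  fixes f :: "'i \<Rightarrow> 'a::euclidean_space \<Rightarrow> 'a"
  assumes fin: "finite I" "I \<noteq> {}" and q: "0 \<le> q" "q < 1"
    and cont: "\<And>i. i \<in> I \<Longrightarrow> continuous_on UNIV (f i)"
    and lip: "\<And>w x y. w \<in> words I k \<Longrightarrow>
        dist (compose_word f w x) (compose_word f w y) \<le> q * dist x y"
  shows "\<exists>!A. is_attractor I f A"
proof (rule ex_ex1I)
  have sub: "A \<subseteq> B"
    if "is_attractor (words I k) (compose_word f) A" "is_attractor (words I k) (compose_word f) B" for A B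
    using attractor_subset[of q "words I k" "compose_word f"] q lip that by blast
  have "words I k \<noteq> {}" by (induction k) (use fin in \<open>auto simp: words_Suc\<close>)
  then obtain A where A: "is_attractor (words I k) (compose_word f) A"
    using attractor_exists[of "words I k" q "compose_word f"] finite_words[OF fin(1)] q lip by blast
  have "is_attractor (words I k) (compose_word f) (hutchinson I f A)"
  proof -
    have "hutchinson I f A \<noteq> {}" using A fin by (auto simp: is_attractor_def hutchinson_def)
    moreover have "(hutchinson I f ^^ k) (hutchinson I f A) = hutchinson I f A"
      using A by (simp add: is_attractor_hutchinson funpow_swap1[symmetric] flip: hutchinson_words)
    ultimately show ?thesis
      using A fin cont by (simp add: is_attractor_hutchinson compact_hutchinson flip: hutchinson_words)
  qed
  then have "hutchinson I f A = A"
    using sub A by blast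
  then show "\<exists>A. is_attractor I f A"
    using A by (auto simp: is_attractor_hutchinson)
  show "A = B" if "is_attractor I f A" "is_attractor I f B" for A B
    using sub[of A B] sub[of B A] attractor_words[OF that(1)] attractor_words[OF that(2)] by blast
qed

section \<open>Similarities\<close>

text \<open>In contrast to a contraction ratio, the factor \<open>1\<close> is allowed, so that the identity, that is the
  empty word, is included.\<close>

definition scales_by :: "('a::metric_space \<Rightarrow> 'a) \<Rightarrow> real \<Rightarrow> bool" where
  "scales_by h \<rho> \<longleftrightarrow> 0 < \<rho> \<and> (\<forall>x y. dist (h x) (h y) = \<rho> * dist x y)"

lemma scales_by_id: "scales_by id 1"
  by (simp add: scales_by_def)

lemma scales_by_compose: "scales_by g \<rho> \<Longrightarrow> scales_by h \<sigma> \<Longrightarrow> scales_by (g \<circ> h) (\<rho> * \<sigma>)"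
  by (simp add: scales_by_def)

lemma scales_by_inj: "scales_by h \<rho> \<Longrightarrow> inj h"
  by (metis scales_by_def dist_eq_0_iff injI mult_eq_0_iff order_less_irrefl)

lemma scales_by_continuous: "scales_by h \<rho> \<Longrightarrow> continuous_on S h"
  by (rule lipschitz_on_continuous_on[of \<rho>]) (auto simp: scales_by_def intro: lipschitz_onI)

text \<open>Up to a translation a similarity is linear, and an injective linear endomorphism of a Euclidean
  space is onto.\<close>

lemma scales_by_surj:
  fixes h :: "'a::euclidean_space \<Rightarrow> 'a"
  assumes "scales_by h \<rho>" shows "surj h"
proof -
  let ?L = "\<lambda>x. h x - h 0"
  have "linear ?L"
    using assms by (intro scaling_linear[where c = \<rho>]) (auto simp: scales_by_def dist_norm)
  moreover have "inj ?L" using scales_by_inj[OF assms] by (auto simp: inj_def)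
  ultimately have "surj ?L" by (rule linear_inj_imp_surj)
  show ?thesis unfolding surj_def
  proof
    fix y
    obtain x where "y - h 0 = h x - h 0" using surjD[OF \<open>surj ?L\<close>, of "y - h 0"] by blast
    then show "\<exists>x. y = h x" by auto
  qed
qed

lemma scales_by_ball:
  fixes h :: "'a::euclidean_space \<Rightarrow> 'a"
  assumes "scales_by h \<rho>" shows "ball (h x) (\<rho> * a) \<subseteq> h ` ball x a"
proof
  fix y assume y: "y \<in> ball (h x) (\<rho> * a)"
  obtain z where "y = h z" using scales_by_surj[OF assms] by (metis surjD)
  with y assms show "y \<in> h ` ball x a" by (auto simp: scales_by_def)
qed

lemma diameter_scales_by:
  assumes "scales_by h \<rho>" "bounded A"
  shows "bounded (h ` A)" "diameter (h ` A) \<le> \<rho> * diameter A"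
proof -
  have h: "0 < \<rho>" "\<And>x y. dist (h x) (h y) = \<rho> * dist x y"
    using assms(1) by (auto simp: scales_by_def)
  have le: "dist u v \<le> \<rho> * diameter A" if "u \<in> h ` A" "v \<in> h ` A" for u v
    using that h diameter_bounded_bound[OF assms(2)] by auto
  then show "bounded (h ` A)" by (auto simp: bounded_two_points)
  show "diameter (h ` A) \<le> \<rho> * diameter A"
  proof (cases "A = {}")
    case False
    then show ?thesis
      unfolding diameter_def[of "h ` A"] using le by (auto intro!: cSUP_least)
  qed (simp add: diameter_empty)
qed

lemma compose_word_scales_by:
  assumes "\<And>i. i \<in> set w \<Longrightarrow> scales_by (g i) (r i)"
  shows "scales_by (compose_word g w) (prod_list (map r w))"
  using assms by (induction w) (simp_all add: scales_by_id scales_by_compose)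

section \<open>The upper bound for the dimension\<close>

lemma hausdorff_premeasure_finite_cover:
  assumes "finite W" "A \<subseteq> (\<Union>w\<in>W. C w)" "0 \<le> \<delta>"
    and "\<And>w. w \<in> W \<Longrightarrow> bounded (C w) \<and> diameter (C w) \<le> \<delta>"
  shows "hausdorff_premeasure t \<delta> A \<le> (\<Sum>w\<in>W. diam_power t (C w))"
proof -
  obtain e where e: "bij_betw e {..<card W} W"
    using ex_bij_betw_nat_finite[OF assms(1)] by (auto simp: atLeast0LessThan)
  define U where "U j = (if j < card W then C (e j) else {})" for j
  have eW: "e j \<in> W" if "j < card W" for j using e that by (auto simp: bij_betw_def)
  have "A \<subseteq> (\<Union>j. U j)"
  proof
    fix x assume "x \<in> A"
    then obtain w where w: "w \<in> W" "x \<in> C w" using assms(2) by auto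
    then have "w \<in> e ` {..<card W}" using bij_betw_imp_surj_on[OF e] by simp
    then obtain j where "j < card W" "e j = w" by blast
    then have "x \<in> U j" using w by (simp add: U_def)
    then show "x \<in> (\<Union>j. U j)" by blast
  qed
  moreover have "bounded (U j) \<and> diameter (U j) \<le> \<delta>" for j
    using assms(3,4) eW by (auto simp: U_def diameter_empty)
  ultimately have "hausdorff_premeasure t \<delta> A \<le> (\<Sum>j. diam_power t (U j))"
    unfolding hausdorff_premeasure_def by (intro INF_lower) auto
  also have "\<dots> = (\<Sum>j<card W. diam_power t (U j))"
    by (rule suminf_finite) (auto simp: U_def diam_power_def)
  also have "\<dots> = (\<Sum>j<card W. diam_power t (C (e j)))" by (simp add: U_def)
  also have "\<dots> = (\<Sum>w\<in>W. diam_power t (C w))" by (rule sum.reindex_bij_betw[OF e])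
  finally show ?thesis .
qed

lemma prod_list_powr:
  fixes r :: "'i \<Rightarrow> real"
  assumes "\<And>i. i \<in> set w \<Longrightarrow> 0 < r i"
  shows "prod_list (map r w) powr t = prod_list (map (\<lambda>i. r i powr t) w)"
    and "0 < prod_list (map r w)"
  using assms by (induction w) (auto simp: powr_mult)

lemma prod_list_le_power:
  fixes r :: "'i \<Rightarrow> real"
  assumes "\<And>i. i \<in> set w \<Longrightarrow> 0 < r i \<and> r i \<le> q"
  shows "prod_list (map r w) \<le> q ^ length w"
  using assms
proof (induction w)
  case (Cons i w)
  then have "r i * prod_list (map r w) \<le> q * q ^ length w"
    by (intro mult_mono) (auto intro: less_imp_le prod_list_powr(2) order.trans)
  then show ?case by simp
qed simp

text \<open>The pieces of level \<open>N\<close> cover the attractor, their diameters tend to zero uniformly, and the sum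
  of the \<open>t\<close>-th powers of their diameters is at most the \<open>N\<close>-th power of the Moran sum, up to a
  constant.\<close>

lemma hausdorff_measure_eq_0_above:
  fixes g :: "'i \<Rightarrow> 'a::metric_space \<Rightarrow> 'a"
  assumes fin: "finite I" and q: "q < 1"
    and sim: "\<And>i. i \<in> I \<Longrightarrow> scales_by (g i) (r i) \<and> r i \<le> q"
    and A: "is_attractor I g A"
    and t: "0 < t" "(\<Sum>i\<in>I. r i powr t) < 1"
  shows "hausdorff_measure t A = 0"
proof -
  define D where "D = diameter A"
  have bA: "bounded A" using A by (simp add: is_attractor_def compact_imp_bounded)
  have "0 \<le> D" unfolding D_def using bA by (rule diameter_ge_0)
  obtain i where i: "i \<in> I" using A by (auto simp: is_attractor_def)
  have "0 < q" using sim[OF i] by (auto simp: scales_by_def)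
  have r: "0 < r i" if "i \<in> I" for i using sim[OF that] by (simp add: scales_by_def)
  define S where "S = (\<Sum>i\<in>I. r i powr t)"
  have S: "0 \<le> S" "S < 1" using t by (auto simp: S_def sum_nonneg)
  have bound: "hausdorff_premeasure t \<delta> A \<le> ennreal (D powr t * S ^ N)" if N: "q ^ N * D \<le> \<delta>" for \<delta> N
  proof -
    have piece: "scales_by (compose_word g w) (prod_list (map r w))"
      "prod_list (map r w) \<le> q ^ N" "0 < prod_list (map r w)"
      "prod_list (map r w) powr t = prod_list (map (\<lambda>i. r i powr t) w)" if "w \<in> words I N" for w
      using that sim r compose_word_scales_by[of w g r] prod_list_le_power[of w r q]
        prod_list_powr[of w r] by (auto simp: words_def subset_iff)
    have small: "bounded (compose_word g w ` A)"
      "diameter (compose_word g w ` A) \<le> prod_list (map r w) * D" if "w \<in> words I N" for w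
      using diameter_scales_by[OF piece(1)[OF that] bA] by (auto simp: D_def)
    have "hausdorff_premeasure t \<delta> A \<le> (\<Sum>w\<in>words I N. diam_power t (compose_word g w ` A))"
    proof (rule hausdorff_premeasure_finite_cover)
      show "finite (words I N)" by (rule finite_words[OF fin])
      show "A \<subseteq> (\<Union>w\<in>words I N. compose_word g w ` A)"
        using attractor_words[OF A, of N] by (auto simp: is_attractor_def)
      show "0 \<le> \<delta>" using N \<open>0 < q\<close> \<open>0 \<le> D\<close> by (meson order.trans mult_nonneg_nonneg zero_le_power less_imp_le)
      show "bounded (compose_word g w ` A) \<and> diameter (compose_word g w ` A) \<le> \<delta>"
        if "w \<in> words I N" for w
        using small[OF that] mult_right_mono[OF piece(2)[OF that] \<open>0 \<le> D\<close>] N by auto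
    qed
    also have "\<dots> \<le> (\<Sum>w\<in>words I N. ennreal (D powr t * prod_list (map (\<lambda>i. r i powr t) w)))"
    proof (rule sum_mono)
      fix w assume w: "w \<in> words I N"
      have "diameter (compose_word g w ` A) powr t \<le> (prod_list (map r w) * D) powr t"
        using small[OF w] t by (intro powr_mono2) (auto intro: diameter_ge_0)
      also have "\<dots> = D powr t * prod_list (map (\<lambda>i. r i powr t) w)"
        using piece[OF w] \<open>0 \<le> D\<close> by (simp add: powr_mult)
      finally show "diam_power t (compose_word g w ` A)
          \<le> ennreal (D powr t * prod_list (map (\<lambda>i. r i powr t) w))"
        using t by (auto simp: diam_power_def intro: ennreal_leI)
    qed
    also have "\<dots> = ennreal (\<Sum>w\<in>words I N. D powr t * prod_list (map (\<lambda>i. r i powr t) w))"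
      by (rule sum_ennreal) (auto intro!: mult_nonneg_nonneg prod_list_nonneg)
    also have "\<dots> = ennreal (D powr t * S ^ N)"
      by (simp add: S_def sum_words_prod_list flip: sum_distrib_left)
    finally show ?thesis .
  qed
  have "hausdorff_premeasure t \<delta> A = 0" if "0 < \<delta>" for \<delta>
  proof -
    have "(\<lambda>N. q ^ N * D) \<longlonglongrightarrow> 0 * D"
      using q \<open>0 < q\<close> by (intro tendsto_intros LIMSEQ_realpow_zero) auto
    then have "\<forall>\<^sub>F N in sequentially. q ^ N * D < \<delta>"
      using \<open>0 < \<delta>\<close> by (auto dest: order_tendstoD(2))
    then have ev: "\<forall>\<^sub>F N in sequentially. hausdorff_premeasure t \<delta> A \<le> ennreal (D powr t * S ^ N)"
      by eventually_elim (simp add: bound)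
    have "(\<lambda>N. D powr t * S ^ N) \<longlonglongrightarrow> D powr t * 0"
      using S by (intro tendsto_intros LIMSEQ_realpow_zero)
    then have "(\<lambda>N. ennreal (D powr t * S ^ N)) \<longlonglongrightarrow> ennreal 0"
      by (intro tendsto_ennrealI) simp
    then have "hausdorff_premeasure t \<delta> A \<le> ennreal 0"
      by (rule tendsto_lowerbound[OF _ ev]) simp
    then show ?thesis by simp
  qed
  then show ?thesis by (simp add: hausdorff_measure_def)
qed

section \<open>The lower bound for the dimension\<close>

text \<open>The discrete stand-in for the self-similar measure: \<open>orbit_mass I g p x V N h\<close> is the sum of
  \<open>p i\<^sub>1 * \<dots> * p i\<^sub>N\<close> over the words of length \<open>N\<close> for which \<open>h (g i\<^sub>1 (\<dots> (g i\<^sub>N x)))\<close> lies in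
  \<open>V\<close>. The prefix \<open>h\<close> is the cell in which the remaining letters act; carrying it as an argument
  makes induction on \<open>N\<close> possible without words and stopping times.\<close>

primrec orbit_mass ::
    "'i set \<Rightarrow> ('i \<Rightarrow> 'a \<Rightarrow> 'a) \<Rightarrow> ('i \<Rightarrow> real) \<Rightarrow> 'a \<Rightarrow> 'a set \<Rightarrow> nat \<Rightarrow> ('a \<Rightarrow> 'a) \<Rightarrow> real" where
  "orbit_mass I g p x V 0 h = indicator V (h x)"
| "orbit_mass I g p x V (Suc N) h = (\<Sum>i\<in>I. p i * orbit_mass I g p x V N (h \<circ> g i))"

lemma orbit_mass_nonneg:
  "(\<And>i. i \<in> I \<Longrightarrow> 0 \<le> p i) \<Longrightarrow> 0 \<le> orbit_mass I g p x V N h"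
  by (induction N arbitrary: h) (auto intro!: sum_nonneg)

lemma orbit_mass_le_1:
  assumes "\<And>i. i \<in> I \<Longrightarrow> 0 \<le> p i" "sum p I = 1"
  shows "orbit_mass I g p x V N h \<le> 1"
proof (induction N arbitrary: h)
  case (Suc N)
  have "(\<Sum>i\<in>I. p i * orbit_mass I g p x V N (h \<circ> g i)) \<le> (\<Sum>i\<in>I. p i * 1)"
    using assms(1) Suc by (intro sum_mono mult_left_mono) auto
  then show ?case using assms(2) by simp
qed (simp add: indicator_def)

lemma orbit_mass_eq_0:
  assumes "x \<in> A" "\<And>i. i \<in> I \<Longrightarrow> g i ` A \<subseteq> A" "h ` A \<inter> V = {}"
  shows "orbit_mass I g p x V N h = 0"
  using assms(3)
proof (induction N arbitrary: h)
  case 0 then show ?case using assms(1) by (auto simp: indicator_def)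
next
  case (Suc N)
  have "(h \<circ> g i) ` A \<inter> V = {}" if "i \<in> I" for i
    using Suc.prems assms(2)[OF that] by fastforce
  then show ?case using Suc.IH by simp
qed

lemma orbit_mass_cover:
  assumes "finite J" "x \<in> A" "\<And>i. i \<in> I \<Longrightarrow> g i ` A \<subseteq> A"
    and p: "\<And>i. i \<in> I \<Longrightarrow> 0 \<le> p i" "sum p I = 1"
    and "h ` A \<subseteq> (\<Union>j\<in>J. V j)"
  shows "1 \<le> (\<Sum>j\<in>J. orbit_mass I g p x (V j) N h)"
  using assms(6)
proof (induction N arbitrary: h)
  case 0
  then obtain j where j: "j \<in> J" "h x \<in> V j" using assms(2) by blast
  then have "1 = (indicator (V j) (h x) :: real)" by simp
  also have "\<dots> \<le> (\<Sum>j\<in>J. indicator (V j) (h x))"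
    by (rule member_le_sum[OF j(1) _ assms(1)]) simp
  finally show ?case by simp
next
  case (Suc N)
  have "(h \<circ> g i) ` A \<subseteq> (\<Union>j\<in>J. V j)" if "i \<in> I" for i
    using Suc.prems assms(3)[OF that] by fastforce
  then have "(\<Sum>i\<in>I. p i * 1) \<le> (\<Sum>i\<in>I. p i * (\<Sum>j\<in>J. orbit_mass I g p x (V j) N (h \<circ> g i)))"
    using Suc.IH p by (intro sum_mono mult_left_mono) auto
  also have "\<dots> = (\<Sum>j\<in>J. orbit_mass I g p x (V j) (Suc N) h)"
    unfolding orbit_mass.simps sum_distrib_left by (rule sum.swap)
  finally show ?case using p by simp
qed

lemma open_Int_ball_fmeasurable:
  fixes S :: "'a::euclidean_space set"
  assumes "open S" shows "S \<inter> ball c R \<in> fmeasurable lborel"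
proof (rule fmeasurableI)
  show "S \<inter> ball c R \<in> sets lborel" using assms by simp
  have "bounded (S \<inter> ball c R)" using bounded_ball by (rule bounded_subset) auto
  then show "emeasure lborel (S \<inter> ball c R) < \<infinity>"
    by (rule emeasure_bounded_finite)
qed

text \<open>The heart of the lower bound. Subdividing a cell \<open>h\<close> splits its mass, and by the open set
  condition the images of \<open>U\<close> under the subcells are disjoint parts of \<open>h ` U\<close>, so the inequality is
  inherited from the subcells. The subdivision stops when the size \<open>\<rho>\<close> of the cell has dropped to
  \<open>d\<close>. There the cell carries mass at most \<open>d powr s\<close>, and if it meets \<open>V\<close> then \<open>h ` U\<close> contains a
  ball of radius comparable to \<open>d\<close> close to \<open>V\<close>, since a single step multiplies the size by at least \<open>r0\<close>.
  The third assumption on \<open>h\<close> guarantees that the cell is small enough before the letters run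
  out.\<close>

lemma orbit_mass_volume_bound:
  fixes g :: "'i \<Rightarrow> 'a::euclidean_space \<Rightarrow> 'a"
  assumes fin: "finite I"
    and sim: "\<And>i. i \<in> I \<Longrightarrow> scales_by (g i) (r i)"
    and r: "\<And>i. i \<in> I \<Longrightarrow> r0 \<le> r i \<and> r i \<le> q" and r0: "0 < r0" and q: "0 < q"
    and s: "0 \<le> s" "(\<Sum>i\<in>I. r i powr s) = 1"
    and A: "x \<in> A" "\<And>i. i \<in> I \<Longrightarrow> g i ` A \<subseteq> A" and b: "\<And>y. y \<in> A \<Longrightarrow> dist z y \<le> b"
    and U: "open U" "\<And>i. i \<in> I \<Longrightarrow> g i ` U \<subseteq> U"
      "\<And>i j. i \<in> I \<Longrightarrow> j \<in> I \<Longrightarrow> i \<noteq> j \<Longrightarrow> g i ` U \<inter> g j ` U = {}"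
    and z: "0 < a" "ball z a \<subseteq> U"
    and V: "c \<in> V" "\<And>u v. u \<in> V \<Longrightarrow> v \<in> V \<Longrightarrow> dist u v \<le> d" and d: "0 < d"
    and h: "scales_by h \<rho>" "r0 * d \<le> \<rho>" "\<rho> * q ^ N \<le> d"
  shows "\<rho> powr s * orbit_mass I g (\<lambda>i. r i powr s) x V N h * measure lborel (ball z (r0 * d * a))
     \<le> d powr s * measure lborel (h ` U \<inter> ball c ((1 + a + b) * d))"
proof -
  let ?M = "orbit_mass I g (\<lambda>i. r i powr s) x V"
  let ?B = "ball c ((1 + a + b) * d)" and ?\<kappa> = "measure lborel (ball z (r0 * d * a))"
  have opn: "open (h ` U)" if "scales_by h \<rho>" for h \<rho>
    using that U(1) by (intro invariance_of_domain scales_by_continuous) (auto intro: inj_on_subset scales_by_inj)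
  have fm: "h ` U \<inter> ?B \<in> fmeasurable lborel" if "scales_by h \<rho>" for h \<rho>
    by (rule open_Int_ball_fmeasurable[OF opn[OF that]])
  have stop: "\<rho> powr s * ?M N h * ?\<kappa> \<le> d powr s * measure lborel (h ` U \<inter> ?B)"
    if h: "scales_by h \<rho>" "r0 * d \<le> \<rho>" "\<rho> \<le> d" for h \<rho> N
  proof (cases "h ` A \<inter> V = {}")
    case True
    have "?M N h = 0" by (rule orbit_mass_eq_0[OF A True])
    then show ?thesis by simp
  next
    case False
    then obtain y where y: "y \<in> A" "h y \<in> V" by auto
    have \<rho>: "0 < \<rho>" "\<And>u v. dist (h u) (h v) = \<rho> * dist u v" using h(1) by (auto simp: scales_by_def)
    \<comment> \<open>If a cell meets \<open>V\<close>, the centre of its inner ball lies within distance \<open>(1 + b) * d\<close> of \<open>c\<close>.\<close>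
    have "dist c (h z) \<le> dist c (h y) + dist (h z) (h y)" by metric
    also have "\<dots> \<le> d + \<rho> * b" using V y b[OF y(1)] \<rho> by (simp add: add_mono mult_left_mono)
    also have "\<dots> \<le> d + d * b"
      using h(3) order.trans[OF zero_le_dist b[OF y(1)]] by (simp add: mult_right_mono)
    finally have cz: "dist c (h z) \<le> d + d * b" .
    have "\<rho> * a \<le> d * a" using h(3) z(1) by simp
    then have "ball (h z) (\<rho> * a) \<subseteq> ?B"
      using cz by (intro subsetI) (simp add: algebra_simps, metric)
    moreover have "ball (h z) (\<rho> * a) \<subseteq> h ` U"
      using scales_by_ball[OF h(1)] z(2) by blast
    ultimately have "measure lborel (ball (h z) (\<rho> * a)) \<le> measure lborel (h ` U \<inter> ?B)"
      by (intro measure_mono_fmeasurable fm[OF h(1)]) auto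
    moreover have "?\<kappa> \<le> measure lborel (ball (h z) (\<rho> * a))"
      using h(2) r0 d z(1) \<rho> by (simp add: content_ball mult_left_mono power_mono)
    ultimately have "?\<kappa> \<le> measure lborel (h ` U \<inter> ?B)" by simp
    moreover have "\<rho> powr s * ?M N h \<le> d powr s * 1"
      using h(3) \<rho> s by (intro mult_mono' powr_mono2 orbit_mass_le_1) (auto simp: orbit_mass_nonneg)
    ultimately show ?thesis by (simp add: mult_mono)
  qed
  show ?thesis
    using h
  proof (induction N arbitrary: h \<rho>)
    case 0
    then show ?case by (intro stop) auto
  next
    case (Suc N)
    show ?case
    proof (cases "\<rho> \<le> d")
      case True
      then show ?thesis using Suc.prems by (intro stop)
    next
      case False
      have \<rho>: "0 < \<rho>" using Suc.prems(1) by (simp add: scales_by_def)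
      let ?C = "\<lambda>i. (h \<circ> g i) ` U \<inter> ?B"
      have child: "scales_by (h \<circ> g i) (\<rho> * r i)" if "i \<in> I" for i
        using Suc.prems(1) sim[OF that] by (rule scales_by_compose)
      have IH: "(\<rho> * r i) powr s * ?M N (h \<circ> g i) * ?\<kappa> \<le> d powr s * measure lborel (?C i)" if "i \<in> I" for i
      proof (rule Suc.IH[OF child[OF that]])
        show "r0 * d \<le> \<rho> * r i"
          using r[OF that] r0 d False \<rho> mult_mono[of r0 "r i" d \<rho>] by (simp add: mult.commute)
        have "r i * q ^ N \<le> q * q ^ N" using r[OF that] q by (intro mult_right_mono) auto
        then have "\<rho> * (r i * q ^ N) \<le> \<rho> * q ^ Suc N" using \<rho> by (simp add: mult_left_mono)
        then show "\<rho> * r i * q ^ N \<le> d" using Suc.prems(3) by (simp add: mult.assoc)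
      qed
      have disj: "disjoint_family_on ?C I"
      proof -
        have "(h \<circ> g i) ` U \<inter> (h \<circ> g j) ` U = {}" if "i \<in> I" "j \<in> I" "i \<noteq> j" for i j
          using U(3)[OF that] scales_by_inj[OF Suc.prems(1)] by (auto simp: inj_def)
        then show ?thesis by (fastforce simp: disjoint_family_on_def)
      qed
      have "\<rho> powr s * ?M (Suc N) h * ?\<kappa> = (\<Sum>i\<in>I. (\<rho> * r i) powr s * ?M N (h \<circ> g i) * ?\<kappa>)"
        using \<rho> r r0 by (simp add: powr_mult sum_distrib_left sum_distrib_right mult_ac)
      also have "\<dots> \<le> (\<Sum>i\<in>I. d powr s * measure lborel (?C i))"
        by (intro sum_mono IH)
      also have "\<dots> = d powr s * measure lborel (\<Union>i\<in>I. ?C i)"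
        unfolding sum_distrib_left[symmetric]
      proof (subst measure_finite_Union[OF fin _ disj])
        show "?C ` I \<subseteq> sets lborel" by (rule image_subsetI) (rule fmeasurableD[OF fm[OF child]])
        show "emeasure lborel (?C i) \<noteq> \<infinity>" if "i \<in> I" for i
          using fmeasurableD2[OF fm[OF child[OF that]]] by simp
      qed simp
      also have "measure lborel (\<Union>i\<in>I. ?C i) \<le> measure lborel (h ` U \<inter> ?B)"
      proof (intro measure_mono_fmeasurable fm[OF Suc.prems(1)])
        show "(\<Union>i\<in>I. ?C i) \<subseteq> h ` U \<inter> ?B" using U(2) by fastforce
        show "(\<Union>i\<in>I. ?C i) \<in> sets lborel"
          using fin by (rule sets.finite_UN) (rule fmeasurableD[OF fm[OF child]])
      qed
      finally show ?thesis by (simp add: mult_left_mono)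
    qed
  qed
qed

text \<open>The mass distribution principle: applied to the identity, the volume bound compares the inner
  balls of the cells with one ball of radius \<open>(1 + a + b) * d\<close>; the quotient of the two volumes
  is independent of \<open>d\<close>.\<close>

lemma orbit_mass_le_diameter_power:
  fixes g :: "'i \<Rightarrow> 'a::euclidean_space \<Rightarrow> 'a"
  assumes fin: "finite I"
    and sim: "\<And>i. i \<in> I \<Longrightarrow> scales_by (g i) (r i)"
    and r: "\<And>i. i \<in> I \<Longrightarrow> r i < 1"
    and s: "0 \<le> s" "(\<Sum>i\<in>I. r i powr s) = 1"
    and A: "is_attractor I g A" "x \<in> A"
    and osc: "open_set_condition I g"
  obtains K where "0 < K"
    "\<And>d. 0 < d \<Longrightarrow> d \<le> 1 \<Longrightarrow> \<exists>N0. \<forall>N\<ge>N0. \<forall>V. (\<forall>u\<in>V. \<forall>v\<in>V. dist u v \<le> d) \<longrightarrow>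
        orbit_mass I g (\<lambda>i. r i powr s) x V N id \<le> K * d powr s"
proof -
  obtain U where U0: "open U" "U \<noteq> {}" "(\<Union>i\<in>I. g i ` U) \<subseteq> U"
      "\<forall>i\<in>I. \<forall>j\<in>I. i \<noteq> j \<longrightarrow> g i ` U \<inter> g j ` U = {}"
    using osc unfolding open_set_condition_def by (elim exE conjE)
  have U: "open U" "U \<noteq> {}" "\<And>i. i \<in> I \<Longrightarrow> g i ` U \<subseteq> U"
      "\<And>i j. i \<in> I \<Longrightarrow> j \<in> I \<Longrightarrow> i \<noteq> j \<Longrightarrow> g i ` U \<inter> g j ` U = {}"
    using U0 by simp_all blast
  obtain z where "z \<in> U" using U(2) by blast
  then obtain a where z: "0 < a" "ball z a \<subseteq> U" using U(1) openE by blast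
  have inv: "g i ` A \<subseteq> A" if "i \<in> I" for i using A(1) that by (auto simp: is_attractor_def)
  have "bounded A" using A(1) by (simp add: is_attractor_def compact_imp_bounded)
  then obtain b where b: "\<And>y. y \<in> A \<Longrightarrow> dist z y \<le> b" by (auto simp: bounded_any_center[of A z])
  have "0 \<le> b" using order.trans[OF zero_le_dist b[OF A(2)]] .
  have ne: "I \<noteq> {}" using A by (auto simp: is_attractor_def)
  define r0 where "r0 = Min (r ` I)"
  define q where "q = Max (r ` I)"
  have rpos: "0 < r i" if "i \<in> I" for i using sim[OF that] by (simp add: scales_by_def)
  have r0: "0 < r0" and q: "0 < q" "q < 1" and rb: "\<And>i. i \<in> I \<Longrightarrow> r0 \<le> r i \<and> r i \<le> q"
    using fin ne rpos r by (auto simp: r0_def q_def Max_gr_iff)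
  have "r0 \<le> 1" using ne rb q by fastforce
  define K where "K = ((1 + a + b) / (r0 * a)) ^ DIM('a)"
  have "0 < K" using z r0 \<open>0 \<le> b\<close> by (simp add: K_def)
  moreover have "\<exists>N0. \<forall>N\<ge>N0. \<forall>V. (\<forall>u\<in>V. \<forall>v\<in>V. dist u v \<le> d) \<longrightarrow>
        orbit_mass I g (\<lambda>i. r i powr s) x V N id \<le> K * d powr s" if d: "0 < d" "d \<le> 1" for d
  proof -
    obtain N0 where N0: "q ^ N0 < d" using real_arch_pow_inv[OF d(1) q(2)] by blast
    have "orbit_mass I g (\<lambda>i. r i powr s) x V N id \<le> K * d powr s"
      if "N \<ge> N0" and V: "\<forall>u\<in>V. \<forall>v\<in>V. dist u v \<le> d" for N V
    proof (cases "V = {}")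
      case True
      have "orbit_mass I g (\<lambda>i. r i powr s) x V N id = 0"
        by (rule orbit_mass_eq_0[OF A(2) inv]) (use True in auto)
      then show ?thesis using \<open>0 < K\<close> by simp
    next
      case False
      then obtain c where c: "c \<in> V" by blast
      let ?M = "orbit_mass I g (\<lambda>i. r i powr s) x V N id"
      have "q ^ N \<le> q ^ N0" using that(1) q by (intro power_decreasing) auto
      then have "?M * measure lborel (ball z (r0 * d * a))
          \<le> d powr s * measure lborel (id ` U \<inter> ball c ((1 + a + b) * d))"
      proof -
        have "1 powr s * ?M * measure lborel (ball z (r0 * d * a))
            \<le> d powr s * measure lborel (id ` U \<inter> ball c ((1 + a + b) * d))"
        proof (rule orbit_mass_volume_bound[where A = A])
          show "r0 * d \<le> 1" using mult_mono[OF \<open>r0 \<le> 1\<close> d(2)] d r0 by simp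
          show "1 * q ^ N \<le> d" using \<open>q ^ N \<le> q ^ N0\<close> N0 by simp
          show "\<And>u v. u \<in> V \<Longrightarrow> v \<in> V \<Longrightarrow> dist u v \<le> d" using V by blast
        qed (fact fin sim rb r0 q(1) s A(2) inv b U(1,3,4) z c d(1) scales_by_id)+
        then show ?thesis by simp
      qed
      also have "\<dots> \<le> d powr s * measure lborel (ball c ((1 + a + b) * d))"
        using U(1) by (intro mult_left_mono measure_mono_fmeasurable)
          (auto intro: open_Int_ball_fmeasurable[of UNIV, simplified])
      finally have "?M * (unit_ball_vol (DIM('a)) * (r0 * d * a) ^ DIM('a))
          \<le> d powr s * (unit_ball_vol (DIM('a)) * ((1 + a + b) * d) ^ DIM('a))"
        using r0 d z \<open>0 \<le> b\<close> by (simp add: content_ball)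
      also have "((1 + a + b) * d) ^ DIM('a) = K * (r0 * d * a) ^ DIM('a)"
        using r0 z d by (simp add: K_def flip: power_mult_distrib)
      finally have "?M * (unit_ball_vol (DIM('a)) * (r0 * d * a) ^ DIM('a))
          \<le> (K * d powr s) * (unit_ball_vol (DIM('a)) * (r0 * d * a) ^ DIM('a))"
        by (simp only: mult_ac)
      moreover have "0 < unit_ball_vol (DIM('a)) * (r0 * d * a) ^ DIM('a)"
        using r0 d z by simp
      ultimately show ?thesis by (rule mult_right_le_imp_le)
    qed
    then show ?thesis by blast
  qed
  ultimately show thesis by (rule that)
qed

text \<open>The members of a cover are enlarged slightly to open sets, so that finitely many of them suffice
  and a single level \<open>N\<close> serves for all of these. The total mass \<open>1\<close> is then at most a constant
  times the sum of the \<open>s\<close>-th powers of the diameters. For diameters at most \<open>1\<close> the \<open>t\<close>-th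
  powers are no smaller.\<close>

lemma hausdorff_measure_nonzero_below:
  fixes g :: "'i \<Rightarrow> 'a::euclidean_space \<Rightarrow> 'a"
  assumes fin: "finite I"
    and sim: "\<And>i. i \<in> I \<Longrightarrow> scales_by (g i) (r i)"
    and r: "\<And>i. i \<in> I \<Longrightarrow> r i < 1"
    and s: "(\<Sum>i\<in>I. r i powr s) = 1"
    and A: "is_attractor I g A"
    and osc: "open_set_condition I g"
    and t: "0 \<le> t" "t < s"
  shows "hausdorff_measure t A \<noteq> 0"
proof -
  have "0 < s" using t by simp
  have "compact A" "A \<noteq> {}" using A by (auto simp: is_attractor_def)
  then obtain x where x: "x \<in> A" by blast
  have inv: "g i ` A \<subseteq> A" if "i \<in> I" for i using A that by (auto simp: is_attractor_def)
  obtain K where K: "0 < K"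
    "\<And>d. 0 < d \<Longrightarrow> d \<le> 1 \<Longrightarrow> \<exists>N0. \<forall>N\<ge>N0. \<forall>V. (\<forall>u\<in>V. \<forall>v\<in>V. dist u v \<le> d) \<longrightarrow>
        orbit_mass I g (\<lambda>i. r i powr s) x V N id \<le> K * d powr s"
    by (rule orbit_mass_le_diameter_power[OF fin sim r less_imp_le[OF \<open>0 < s\<close>] s A x osc]) blast+
  define \<epsilon> where "\<epsilon> = 1 / (4 * K)"
  have "0 < \<epsilon>" using K(1) by (simp add: \<epsilon>_def)
  have lower: "ennreal (1 / (2 * K)) \<le> (\<Sum>i. diam_power t (U i))"
    if U: "A \<subseteq> (\<Union>i. U i)" "\<And>i. bounded (U i)" "\<And>i. diameter (U i) \<le> 1 / 2" for U :: "nat \<Rightarrow> 'a set"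
  proof -
    have dn: "0 \<le> diameter (U i)" for i using U(2) by (rule diameter_ge_0)
    \<comment> \<open>The enlarged sets cost at most \<open>2 * \<epsilon>\<close> in total, half of the mass after multiplication by \<open>K\<close>. Members of diameter zero become sets of positive size as well.\<close>
    have "\<exists>d. diameter (U i) < d \<and> d \<le> 1 \<and> d powr s \<le> diameter (U i) powr s + \<epsilon> * (1 / 2) ^ i" for i
    proof -
      let ?D = "diameter (U i)"
      have "((\<lambda>d. d powr s) \<longlongrightarrow> ?D powr s) (at_right ?D)"
        using \<open>0 < s\<close> dn[of i]
        by (intro tendsto_powr' tendsto_const tendsto_ident_at) (auto simp: eventually_at_filter intro!: always_eventually)
      then have "\<forall>\<^sub>F d in at_right ?D. d powr s < ?D powr s + \<epsilon> * (1 / 2) ^ i"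
        using \<open>0 < \<epsilon>\<close> by (intro order_tendstoD(2)) auto
      moreover have "\<forall>\<^sub>F d in at_right ?D. d \<in> {?D<..<1}"
        using U(3)[of i] by (intro eventually_at_right_real) simp
      ultimately have "\<forall>\<^sub>F d in at_right ?D. d powr s < ?D powr s + \<epsilon> * (1 / 2) ^ i \<and> d \<in> {?D<..<1}"
        by eventually_elim simp
      from eventually_happens'[OF _ this] show ?thesis
        by (auto simp: trivial_limit_at_right_real intro: less_imp_le)
    qed
    then obtain d where d: "\<And>i. diameter (U i) < d i" "\<And>i. d i \<le> 1"
      "\<And>i. d i powr s \<le> diameter (U i) powr s + \<epsilon> * (1 / 2) ^ i" by metis
    have dpos: "0 < d i" for i using dn[of i] d(1)[of i] by linarith
    define V where "V i = (\<Union>u\<in>U i. ball u ((d i - diameter (U i)) / 2))" for i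
    have Vd: "dist u v \<le> d i" if uv: "u \<in> V i" "v \<in> V i" for u v i
    proof -
      obtain u' v' where *: "u' \<in> U i" "v' \<in> U i" "dist u' u < (d i - diameter (U i)) / 2"
        "dist v' v < (d i - diameter (U i)) / 2" using uv unfolding V_def UN_iff mem_ball by blast
      have "dist u v \<le> dist u' u + dist u' v' + dist v' v" by metric
      then show ?thesis using * diameter_bounded_bound[OF U(2) *(1,2)] by argo
    qed
    have UV: "U i \<subseteq> V i" for i using d(1)[of i] by (force simp: V_def)
    have cover: "A \<subseteq> (\<Union>i. V i)"
      using U(1) UN_mono[OF order_refl UV] by (rule order.trans)
    have opn: "open (V i)" for i by (auto simp: V_def)
    obtain J where J: "finite J" "A \<subseteq> (\<Union>j\<in>J. V j)"
      by (rule compactE_image[OF \<open>compact A\<close> opn cover])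
    have "\<forall>j. \<exists>N0. \<forall>N\<ge>N0. \<forall>W. (\<forall>u\<in>W. \<forall>v\<in>W. dist u v \<le> d j) \<longrightarrow>
        orbit_mass I g (\<lambda>i. r i powr s) x W N id \<le> K * d j powr s"
      by (intro allI K(2) dpos d(2))
    from choice[OF this] obtain N0 where N0: "\<And>j N W. N \<ge> N0 j \<Longrightarrow> \<forall>u\<in>W. \<forall>v\<in>W. dist u v \<le> d j \<Longrightarrow>
        orbit_mass I g (\<lambda>i. r i powr s) x W N id \<le> K * d j powr s" by blast
    define N where "N = (\<Sum>j\<in>J. N0 j)"
    have N: "N0 j \<le> N" if "j \<in> J" for j
      unfolding N_def using J(1) that by (intro member_le_sum) auto
    have "1 \<le> (\<Sum>j\<in>J. orbit_mass I g (\<lambda>i. r i powr s) x (V j) N id)"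
      by (rule orbit_mass_cover[where A = A]) (use J x inv s in auto)
    also have "\<dots> \<le> (\<Sum>j\<in>J. K * d j powr s)"
      using N Vd by (intro sum_mono N0) auto
    also have "\<dots> \<le> K * (\<Sum>j\<in>J. diameter (U j) powr s + \<epsilon> * (1 / 2) ^ j)"
      unfolding sum_distrib_left[symmetric] using K(1) d(3) by (intro mult_left_mono sum_mono) auto
    also have "\<dots> \<le> K * ((\<Sum>j\<in>J. diameter (U j) powr s) + 2 * \<epsilon>)"
    proof -
      have "(\<Sum>j\<in>J. (1 / 2 :: real) ^ j) \<le> (\<Sum>j. (1 / 2) ^ j)"
        using J(1) by (intro sum_le_suminf summable_geometric) auto
      also have "\<dots> = 2" by (subst suminf_geometric) auto
      finally show ?thesis
        using K(1) \<open>0 < \<epsilon>\<close> by (simp add: sum.distrib flip: sum_distrib_left)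
    qed
    finally have "1 / (2 * K) \<le> (\<Sum>j\<in>J. diameter (U j) powr s)"
      using K(1) by (simp add: \<epsilon>_def field_simps)
    then have "ennreal (1 / (2 * K)) \<le> (\<Sum>j\<in>J. ennreal (diameter (U j) powr s))"
      by (simp add: ennreal_leI)
    also have "\<dots> \<le> (\<Sum>j\<in>J. diam_power t (U j))"
    proof (rule sum_mono)
      fix j
      have "diameter (U j) powr s \<le> diameter (U j) powr t" "diameter (U j) powr s \<le> 1"
        using dn[of j] U(3)[of j] t powr_mono'[of t s "diameter (U j)"] powr_mono'[of 0 s "diameter (U j)"]
        by (cases "diameter (U j) = 0"; simp)+
      then show "ennreal (diameter (U j) powr s) \<le> diam_power t (U j)"
        by (auto simp: diam_power_def diameter_empty intro!: ennreal_leI)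
    qed
    also have "\<dots> \<le> (\<Sum>i. diam_power t (U i))"
      by (rule sum_le_suminf) (use J(1) in auto)
    finally show ?thesis .
  qed
  have "0 < ennreal (1 / (2 * K))" using K(1) by simp
  also have "\<dots> \<le> hausdorff_premeasure t (1 / 2) A"
    unfolding hausdorff_premeasure_def using lower by (intro INF_greatest) auto
  also have "\<dots> \<le> hausdorff_measure t A"
    unfolding hausdorff_measure_def by (intro SUP_upper) auto
  finally show ?thesis by simp
qed

text \<open>The theorem of Moran and Hutchinson: the two bounds meet because the Moran sum drops below $1$
  as soon as the exponent exceeds \<open>s\<close>.\<close>

theorem hausdorff_dim_self_similar:
  fixes g :: "'i \<Rightarrow> 'a::euclidean_space \<Rightarrow> 'a"
  assumes fin: "finite I"
    and sim: "\<And>i. i \<in> I \<Longrightarrow> scales_by (g i) (r i)"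
    and r: "\<And>i. i \<in> I \<Longrightarrow> r i < 1"
    and s: "0 \<le> s" "(\<Sum>i\<in>I. r i powr s) = 1"
    and A: "is_attractor I g A"
    and osc: "open_set_condition I g"
  shows "hausdorff_dim A = ereal s"
proof (rule antisym)
  have ne: "I \<noteq> {}" using A by (auto simp: is_attractor_def)
  have rpos: "0 < r i" if "i \<in> I" for i using sim[OF that] by (simp add: scales_by_def)
  show "hausdorff_dim A \<le> ereal s"
  proof (rule ereal_le_epsilon2)
    fix e :: real assume "0 < e"
    have "(\<Sum>i\<in>I. r i powr (s + e)) < (\<Sum>i\<in>I. r i powr s)"
      using fin ne rpos r \<open>0 < e\<close> by (intro sum_strict_mono powr_less_mono') auto
    then have "hausdorff_measure (s + e) A = 0"
      using fin sim r s A \<open>0 < e\<close> ne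
      by (intro hausdorff_measure_eq_0_above[of I "Max (r ` I)" g r]) auto
    then show "hausdorff_dim A \<le> ereal s + ereal e"
      unfolding hausdorff_dim_def using s \<open>0 < e\<close> by (intro Inf_lower) auto
  qed
  have "s \<le> t" if "0 \<le> t" "hausdorff_measure t A = 0" for t
  proof (rule ccontr)
    assume "\<not> s \<le> t"
    then have "t < s" by simp
    have "hausdorff_measure t A \<noteq> 0"
      by (rule hausdorff_measure_nonzero_below[OF fin sim r s(2) A osc that(1) \<open>t < s\<close>])
    then show False using that(2) by simp
  qed
  then show "ereal s \<le> hausdorff_dim A"
    unfolding hausdorff_dim_def by (intro Inf_greatest) auto
qed

section \<open>The ratio of a word\<close>

definition volume_factor :: "(real ^ 'm \<Rightarrow> real ^ 'm) \<Rightarrow> real" where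
  "volume_factor h = \<bar>det (matrix (\<lambda>x. h x - h 0))\<bar>"

lemma affine_map_compose:
  assumes "affine_map g" "affine_map h" shows "affine_map (g \<circ> h)"
proof -
  obtain L b M c where "linear L" "g = (\<lambda>x. L x + b)" "linear M" "h = (\<lambda>x. M x + c)"
    using assms unfolding affine_map_def by blast
  then have "g \<circ> h = (\<lambda>x. (L \<circ> M) x + (L c + b))" "linear (L \<circ> M)"
    by (auto simp: linear_add linear_compose)
  then show ?thesis unfolding affine_map_def by blast
qed

lemma affine_map_linear_part:
  assumes "affine_map h" shows "linear (\<lambda>x. h x - h 0)"
proof -
  obtain L b where "linear L" "h = (\<lambda>x. L x + b)"
    using assms unfolding affine_map_def by blast
  then show ?thesis by (simp add: linear_0)
qed

lemma affine_map_continuous: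
  fixes h :: "'a::euclidean_space \<Rightarrow> 'b::real_normed_vector"
  assumes "affine_map h" shows "continuous_on UNIV h"
proof -
  obtain L b where "linear L" "h = (\<lambda>x. L x + b)"
    using assms unfolding affine_map_def by blast
  then show ?thesis
    by (simp only:, intro continuous_on_add continuous_on_const linear_continuous_on)
      (simp add: linear_conv_bounded_linear)
qed

lemma volume_factor_compose:
  assumes "affine_map g" "affine_map h"
  shows "volume_factor (g \<circ> h) = volume_factor g * volume_factor h"
proof -
  obtain L b where L: "linear L" "g = (\<lambda>x. L x + b)"
    using assms unfolding affine_map_def by blast
  have "(\<lambda>x. (g \<circ> h) x - (g \<circ> h) 0) = (\<lambda>x. g x - g 0) \<circ> (\<lambda>x. h x - h 0)"
    using L by (auto simp: linear_diff linear_0)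
  then show ?thesis
    using assms
    by (simp add: volume_factor_def matrix_compose affine_map_linear_part det_mul abs_mult)
qed

lemma affine_map_id: "affine_map id"
  unfolding affine_map_def by (intro exI[of _ id] exI[of _ 0]) (auto simp: linear_id)

lemma volume_factor_id: "volume_factor id = 1"
  by (simp add: volume_factor_def matrix_id_mat_1[unfolded id_def] id_def)

lemma compose_word_affine:
  assumes "\<And>i. i \<in> set w \<Longrightarrow> affine_map (f i)"
  shows "affine_map (compose_word f w)"
    and "volume_factor (compose_word f w) = prod_list (map (\<lambda>i. volume_factor (f i)) w)"
  using assms
  by (induction w) (auto simp: affine_map_id volume_factor_id affine_map_compose volume_factor_compose)

text \<open>Dividing the linear part by the ratio leaves an orthogonal map.\<close>

lemma volume_factor_similarity:
  fixes h :: "real ^ 'm \<Rightarrow> real ^ 'm"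
  assumes "affine_map h" "has_contraction_ratio h \<rho>"
  shows "volume_factor h = \<rho> ^ CARD('m)"
proof -
  let ?L = "\<lambda>x. h x - h 0" and ?M = "\<lambda>x. (1 / \<rho>) *\<^sub>R (h x - h 0)"
  have \<rho>: "0 < \<rho>" "\<And>x y. norm (h x - h y) = \<rho> * norm (x - y)"
    using assms(2) by (auto simp: has_contraction_ratio_def)
  have lin: "linear ?L" by (rule affine_map_linear_part[OF assms(1)])
  then have "linear ?M" by (intro linear_compose_scale_right)
  then have "orthogonal_transformation ?M"
    using \<rho> by (simp add: orthogonal_transformation)
  then have M: "\<bar>det (matrix ?M)\<bar> = 1"
    using det_orthogonal_matrix orthogonal_transformation_matrix by fastforce
  have "?L = (\<lambda>x. \<rho> *\<^sub>R x) \<circ> ?M" using \<rho> by auto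
  then have "det (matrix ?L) = \<rho> ^ CARD('m) * det (matrix ?M)"
    using \<open>linear ?M\<close> by (simp only: matrix_compose[OF \<open>linear ?M\<close> linear_scale_self] det_mul det_matrix_scaleR)
  then show ?thesis
    using M \<rho> by (simp add: volume_factor_def abs_mult)
qed

lemma contraction_ratio_eq:
  fixes h :: "real ^ 'm \<Rightarrow> real ^ 'm"
  assumes "has_contraction_ratio h \<rho>"
  shows "contraction_ratio h = \<rho>"
  unfolding contraction_ratio_def
proof (rule the_equality[where P = "has_contraction_ratio h", OF assms])
  fix \<sigma> assume "has_contraction_ratio h \<sigma>"
  then have "\<sigma> * norm (axis undefined 1 - 0 :: real ^ 'm) = \<rho> * norm (axis undefined 1 - 0 :: real ^ 'm)"
    using assms unfolding has_contraction_ratio_def by metis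
  then show "\<sigma> = \<rho>" by simp
qed

text \<open>Only the compositions of length \<open>k\<close> have ratios, but the volume factor is defined for each letter
  and multiplicative. The power \<open>f i ^^ k\<close> determines the volume factor of \<open>f i\<close> as the power
  \<open>CARD('m)\<close> of \<open>c i powr (1 / k)\<close>, so that \<open>c i powr (1 / k)\<close> acts as the ratio of the
  letter.\<close>

lemma word_ratio_from_letter_ratios:
  fixes f :: "'i \<Rightarrow> real ^ 'm \<Rightarrow> real ^ 'm"
  assumes k: "k \<ge> 1" and w: "w \<in> words I k"
    and aff: "\<And>i. i \<in> I \<Longrightarrow> affine_map (f i)"
    and pow: "\<And>i. i \<in> I \<Longrightarrow> has_contraction_ratio (f i ^^ k) (c i)"
    and \<rho>: "has_contraction_ratio (compose_word f w) \<rho>"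
  shows "\<rho> = prod_list (map (\<lambda>i. c i powr (1 / real k)) w)"
proof -
  let ?m = "CARD('m)" and ?P = "\<lambda>w. prod_list (map (\<lambda>i. c i powr (1 / real k)) w)"
  have vf: "volume_factor (f i) = (c i powr (1 / real k)) ^ ?m" if "i \<in> I" for i
  proof -
    have c: "0 < c i" using pow[OF that] by (simp add: has_contraction_ratio_def)
    have affk: "affine_map (f i ^^ k)" and "volume_factor (f i ^^ k) = volume_factor (f i) ^ k"
      using compose_word_affine[of "replicate k i" f] aff[OF that]
      by (auto simp: compose_word_replicate prod_list_replicate)
    then have "volume_factor (f i) ^ k = c i ^ ?m"
      using volume_factor_similarity[OF affk pow[OF that]] by simp
    also have "\<dots> = ((c i powr (1 / real k)) ^ ?m) ^ k"
      using c k by (simp add: powr_powr flip: powr_realpow power_mult)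
    finally show ?thesis
      using k by (simp add: volume_factor_def power_eq_iff_eq_base)
  qed
  have wI: "set w \<subseteq> I" using w by (simp add: words_def)
  then have "prod_list (map (\<lambda>i. volume_factor (f i)) w) = ?P w ^ ?m"
    by (induction w) (auto simp: vf power_mult_distrib)
  then have "\<rho> ^ ?m = ?P w ^ ?m"
    using compose_word_affine[of w f] volume_factor_similarity[OF _ \<rho>] wI aff by auto
  moreover have "0 \<le> \<rho>" using \<rho> by (simp add: has_contraction_ratio_def)
  moreover have "0 \<le> ?P w" by (induction w) auto
  ultimately show ?thesis by (simp add: power_eq_iff_eq_base)
qed

section \<open>Affine systems whose compositions of fixed length are similarities\<close>

text \<open>The same open set works: two words that differ are separated at their first difference, and the
  common prefix is injective.\<close>

lemma open_set_condition_words: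
  assumes inj: "\<And>i. i \<in> I \<Longrightarrow> inj (f i)" and osc: "open_set_condition I f"
  shows "open_set_condition (words I N) (compose_word f)"
proof -
  obtain U where U: "open U" "U \<noteq> {}" "(\<Union>i\<in>I. f i ` U) \<subseteq> U"
      "\<forall>i\<in>I. \<forall>j\<in>I. i \<noteq> j \<longrightarrow> f i ` U \<inter> f j ` U = {}"
    using osc unfolding open_set_condition_def by (elim exE conjE)
  have sub: "compose_word f w ` U \<subseteq> U" if "w \<in> words I N" for w N
    using that
  proof (induction N arbitrary: w)
    case (Suc N)
    then obtain i v where w: "w = i # v" "i \<in> I" "v \<in> words I N" by (auto simp: words_Suc)
    have "compose_word f w ` U = f i ` compose_word f v ` U" by (simp add: w(1) image_comp)
    also have "\<dots> \<subseteq> f i ` U" by (rule image_mono[OF Suc.IH[OF w(3)]])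
    also have "f i ` U \<subseteq> U" using U(3) w(2) by blast
    finally show ?case .
  qed simp
  have disj: "compose_word f v ` U \<inter> compose_word f w ` U = {}"
    if "v \<in> words I N" "w \<in> words I N" "v \<noteq> w" for v w N
    using that
  proof (induction N arbitrary: v w)
    case (Suc N)
    then obtain i v' j w' where *: "v = i # v'" "i \<in> I" "v' \<in> words I N"
        "w = j # w'" "j \<in> I" "w' \<in> words I N"
      by (auto simp: words_Suc)
    have im: "compose_word f v ` U = f i ` compose_word f v' ` U"
        "compose_word f w ` U = f j ` compose_word f w' ` U"
      by (simp_all add: *(1,4) image_comp)
    show ?case
    proof (cases "i = j")
      case True
      then have "compose_word f v' ` U \<inter> compose_word f w' ` U = {}"
        using Suc.IH[OF *(3,6)] Suc.prems(3) *(1,4) by simp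
      then show ?thesis
        unfolding im True[symmetric] image_Int[OF inj[OF *(2)], symmetric] by simp
    next
      case False
      then have "f i ` U \<inter> f j ` U = {}" using U(4) *(2,5) by simp
      then show ?thesis
        unfolding im using image_mono[OF sub[OF *(3)], of "f i"] image_mono[OF sub[OF *(6)], of "f j"]
        by (simp add: disjoint_iff) (meson subsetD)
    qed
  qed simp
  show ?thesis
    unfolding open_set_condition_def
    by (intro exI[of _ U] conjI ballI impI UN_least) (use U(1,2) sub disj in auto)
qed

lemma has_contraction_ratio_scales_by: "has_contraction_ratio h \<rho> \<Longrightarrow> scales_by h \<rho>"
  by (simp add: has_contraction_ratio_def scales_by_def dist_norm)

theorem theorem4p1:
  fixes f :: "nat \<Rightarrow> real ^ 'm \<Rightarrow> real ^ 'm" and n k :: nat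
  assumes "n \<ge> 1" and "k \<ge> 1"
    and "\<And>i. i \<in> {1..n} \<Longrightarrow> affine_map (f i)"
    and "open_set_condition {1..n} f"
    and "\<And>js. length js = k \<Longrightarrow> set js \<subseteq> {1..n} \<Longrightarrow>
           similarity_contraction (compose_word f js)"
  shows "(\<exists>!A. is_attractor {1..n} f A) \<and>
         (\<forall>A. is_attractor {1..n} f A \<longrightarrow>
            (\<exists>s::real. hausdorff_dim A = ereal s \<and>
               (\<Sum>i=1..n. contraction_ratio (f i ^^ k) powr (s / real k)) = 1 \<and>
               (\<forall>t::real. (\<Sum>i=1..n. contraction_ratio (f i ^^ k) powr (t / real k)) = 1
                  \<longrightarrow> t = s)))"
proof -
  let ?I = "{1..n}" and ?W = "words {1..n} k"
  define c where "c i = contraction_ratio (f i ^^ k)" for i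
  define r where "r i = c i powr (1 / real k)" for i
  have fin: "finite ?I" "?I \<noteq> {}" using assms(1) by auto
  have sim: "\<exists>\<rho>. has_contraction_ratio (compose_word f w) \<rho>" if "w \<in> ?W" for w
    using assms(5)[of w] that by (auto simp: words_def similarity_contraction_def)
  have pow: "has_contraction_ratio (f i ^^ k) (c i)" if "i \<in> ?I" for i
  proof -
    have "replicate k i \<in> ?W" using that by (auto simp: words_def)
    then obtain \<rho> where "has_contraction_ratio (f i ^^ k) \<rho>"
      using sim[of "replicate k i"] by (auto simp: compose_word_replicate)
    then show ?thesis by (simp add: c_def contraction_ratio_eq)
  qed
  have c: "0 < c i \<and> c i < 1" if "i \<in> ?I" for i
    using pow[OF that] by (simp add: has_contraction_ratio_def)
  have r: "0 < r i \<and> r i < 1" if "i \<in> ?I" for i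
    using c[OF that] assms(2) powr_less_mono2[of "1 / real k" "c i" 1] by (simp add: r_def)
  have r_powr: "r i powr t = c i powr (t / real k)" for i t
    by (simp add: r_def powr_powr)
  have word: "has_contraction_ratio (compose_word f w) (prod_list (map r w))" if w: "w \<in> ?W" for w
  proof -
    obtain \<rho> where \<rho>: "has_contraction_ratio (compose_word f w) \<rho>" using sim[OF w] by blast
    have "\<rho> = prod_list (map r w)"
      unfolding r_def by (rule word_ratio_from_letter_ratios[OF assms(2) w assms(3) pow \<rho>])
    with \<rho> show ?thesis by simp
  qed
  have scale: "scales_by (compose_word f w) (prod_list (map r w))"
    and lt1: "prod_list (map r w) < 1" if "w \<in> ?W" for w
    using word[OF that] by (simp_all add: has_contraction_ratio_scales_by) (simp add: has_contraction_ratio_def)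
  obtain s where s: "0 \<le> s" "(\<Sum>i\<in>?I. r i powr s) = 1"
      "\<forall>t. (\<Sum>i\<in>?I. r i powr t) = 1 \<longrightarrow> t = s"
  proof -
    have "\<exists>s\<ge>0. (\<Sum>i\<in>?I. r i powr s) = 1 \<and> (\<forall>t. (\<Sum>i\<in>?I. r i powr t) = 1 \<longrightarrow> t = s)"
      by (rule moran_equation[OF fin r])
    then show thesis using that by blast
  qed
  have attr: "\<exists>!A. is_attractor ?I f A"
  proof -
    have "replicate k 1 \<in> ?W" using assms(1) by (auto simp: words_def)
    then have finW: "finite ?W" "?W \<noteq> {}" using finite_words[OF fin(1)] by auto
    define q where "q = Max ((\<lambda>w. prod_list (map r w)) ` ?W)"
    have q: "prod_list (map r w) \<le> q" if "w \<in> ?W" for w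
      using finW that by (simp add: q_def)
    have "q < 1" using finW lt1 by (simp add: q_def)
    obtain w where "w \<in> ?W" using finW by blast
    then have "0 \<le> q" using q[of w] scale[of w] by (simp add: scales_by_def)
    show ?thesis
    proof (rule attractor_unique_if_words_contract[OF fin \<open>0 \<le> q\<close> \<open>q < 1\<close>])
      show "continuous_on UNIV (f i)" if "i \<in> ?I" for i
        using assms(3)[OF that] by (rule affine_map_continuous)
      show "dist (compose_word f w x) (compose_word f w y) \<le> q * dist x y" if "w \<in> ?W" for w x y
        using scale[OF that] q[OF that] by (simp add: scales_by_def mult_right_mono)
    qed
  qed
  have inj: "inj (f i)" if "i \<in> ?I" for i
  proof -
    obtain k' where k': "k = Suc k'" using assms(2) by (cases k) auto
    \<comment> \<open>In an injective composition the map applied first is injective.\<close>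
    have "inj (f i ^^ k' \<circ> f i)"
      using scales_by_inj[OF has_contraction_ratio_scales_by[OF pow[OF that]]]
      by (simp add: k' funpow_Suc_right del: funpow.simps)
    then show ?thesis by (rule inj_on_imageI2)
  qed
  have dim: "hausdorff_dim A = ereal s" if A: "is_attractor ?I f A" for A
  proof (rule hausdorff_dim_self_similar[where I = ?W and g = "compose_word f"])
    have "(\<Sum>w\<in>?W. prod_list (map r w) powr s) = (\<Sum>w\<in>?W. prod_list (map (\<lambda>i. r i powr s) w))"
      by (intro sum.cong refl prod_list_powr) (use r in \<open>auto simp: words_def\<close>)
    also have "\<dots> = 1" unfolding sum_words_prod_list s(2) by simp
    finally show "(\<Sum>w\<in>?W. prod_list (map r w) powr s) = 1" .
    show "open_set_condition ?W (compose_word f)"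
      by (rule open_set_condition_words[OF inj assms(4)])
  qed (fact finite_words[OF fin(1)] scale lt1 s(1) attractor_words[OF A])+
  show ?thesis
  proof (intro conjI allI impI)
    show "\<exists>!A. is_attractor ?I f A" by (rule attr)
    fix A assume "is_attractor ?I f A"
    then have "hausdorff_dim A = ereal s" by (rule dim)
    then show "\<exists>s::real. hausdorff_dim A = ereal s \<and>
        (\<Sum>i=1..n. contraction_ratio (f i ^^ k) powr (s / real k)) = 1 \<and>
        (\<forall>t::real. (\<Sum>i=1..n. contraction_ratio (f i ^^ k) powr (t / real k)) = 1 \<longrightarrow> t = s)"
      using s(2,3) unfolding r_powr c_def by (intro exI[of _ s] conjI)
  qed
qed

end
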